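(* Let $d\ge2$ be an integer, $a>0$ a constant, fix constants $\tau\ge\epsilon>0$ independent of $n$, and let $n$ be such that $n^{1/d}$ is an integer. Place $n$ sensors in $[0,\infty)^d$ as follows: take $d$ independent homogeneous Poisson processes on $[0,\infty)$, each with rate $n^{1/d}$, let $X^{(j)}_1<\dots<X^{(j)}_{n^{1/d}}$ be the first $n^{1/d}$ arrival times of the $j$-th process, and put one sensor at each point $(X^{(1)}_{i_1},\dots,X^{(d)}_{i_d})$, $1\le i_1,\dots,i_d\le n^{1/d}$. Consider reallocations of the sensors satisfying: (a) sensors move only along the coordinate axes; (b) the final configuration again consists of axis-parallel lines ("rows and columns"): along each coordinate direction there are $n^{(d-1)/d}$ lines each containing $n^{1/d}$ sensors; (c) in each such line, every two consecutive sensors are at distance at least $s$ and at most $v$, where $s=\frac{1+\epsilon}{n^{1/d}}$ and $v=\frac{1+\tau}{n^{1/d}}$. Then the expected minimal $d$-dimensional $a$-total movement of such a reallocation is $\Theta(n)$ if $a\ge1$, and $O(n)$ if $a\in(0,1)$.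
   Context: If a sensor $S_i$ at $(y_1(i),\dots,y_d(i))$ is moved to $(y_1(i)+m_1(i),\dots,y_d(i)+m_d(i))$, the $d$-dimensional $a$-total movement is $\sum_{i=1}^n\sum_{j=1}^d|m_j(i)|^a$. Asymptotics are as $n\to\infty$ with $a,d,\epsilon,\tau$ fixed. *)

theory Defs
  imports "HOL-Probability.Probability" "HOL-Library.Landau_Symbols"
begin

section \<open>Homogeneous Poisson processes\<close>

text \<open>
  A Poisson process on the half-line is given by its counting process: \<open>N t \<omega>\<close> is the number of
  arrivals in the interval from \<open>0\<close> to \<open>t\<close>. The sequence \<open>t\<close> in the independence clause is
  arbitrary; since independence of a family is independence of its finite subfamilies, this covers
  all finite collections of consecutive increments. Truncated subtraction is harmless, because
  the paths are monotone.
\<close>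

definition poisson_process :: "'w measure \<Rightarrow> real \<Rightarrow> (real \<Rightarrow> 'w \<Rightarrow> nat) \<Rightarrow> bool" where
  "poisson_process M rate N \<longleftrightarrow>
     prob_space M \<and>
     (\<forall>t\<ge>0. N t \<in> measurable M (count_space UNIV)) \<and>
     (\<forall>\<omega>\<in>space M. N 0 \<omega> = 0 \<and> mono_on {0..} (\<lambda>t. N t \<omega>) \<and>
        (\<forall>t\<ge>0. continuous (at_right t) (\<lambda>t. N t \<omega>))) \<and>
     (\<forall>r t. 0 \<le> r \<longrightarrow> r < t \<longrightarrow>
        distr M (count_space UNIV) (\<lambda>\<omega>. N t \<omega> - N r \<omega>) = measure_pmf (poisson_pmf (rate * (t - r)))) \<and>
     (\<forall>t :: nat \<Rightarrow> real. mono t \<longrightarrow> 0 \<le> t 0 \<longrightarrow>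
        prob_space.indep_vars M (\<lambda>_. count_space UNIV)
          (\<lambda>i \<omega>. N (t (Suc i)) \<omega> - N (t i) \<omega>) UNIV)"

text \<open>Independence of the processes as whole random paths, not just at fixed times.\<close>

definition independent_poisson_processes ::
    "'w measure \<Rightarrow> real \<Rightarrow> ('d \<Rightarrow> real \<Rightarrow> 'w \<Rightarrow> nat) \<Rightarrow> bool" where
  "independent_poisson_processes M rate N \<longleftrightarrow>
     (\<forall>j. poisson_process M rate (N j)) \<and>
     prob_space.indep_vars M (\<lambda>_. PiM {0..} (\<lambda>_. count_space UNIV))
       (\<lambda>j \<omega>. \<lambda>t\<in>{0..}. N j t \<omega>) UNIV"

definition arrival_time :: "(real \<Rightarrow> 'w \<Rightarrow> nat) \<Rightarrow> nat \<Rightarrow> 'w \<Rightarrow> real" where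
  "arrival_time N k \<omega> = Inf {t. 0 \<le> t \<and> k \<le> N t \<omega>}"


section \<open>Sensors\<close>

text \<open>
  The dimension is \<open>CARD('d)\<close>. Throughout, \<open>m\<close> is the number of sensors on a line, so the number
  of sensors is \<open>n = m ^ CARD('d)\<close> and \<open>m = n powr (1 / CARD('d))\<close>. Sensors are identified with
  their multi-indices, so that several sensors may share a position.
\<close>

definition sensors :: "nat \<Rightarrow> ('d::finite \<Rightarrow> nat) set" where
  "sensors m = UNIV \<rightarrow>\<^sub>E {1..m}"

definition initial_position ::
    "('d::finite \<Rightarrow> real \<Rightarrow> 'w \<Rightarrow> nat) \<Rightarrow> 'w \<Rightarrow> ('d \<Rightarrow> nat) \<Rightarrow> real ^ 'd" where
  "initial_position N \<omega> i = (\<chi> j. arrival_time (N j) (i j) \<omega>)"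


section \<open>Final configurations\<close>

definition axis_parallel_line :: "'d::finite \<Rightarrow> (real ^ 'd) set \<Rightarrow> bool" where
  "axis_parallel_line j L \<longleftrightarrow> (\<exists>p. L = range (\<lambda>t. p + t *\<^sub>R axis j 1))"

text \<open>Sensors of \<open>S\<close> (at positions \<open>y\<close>) lying on \<open>L\<close>.\<close>

definition sensors_on :: "'s set \<Rightarrow> ('s \<Rightarrow> 'v) \<Rightarrow> 'v set \<Rightarrow> 's set" where
  "sensors_on S y L = {i \<in> S. y i \<in> L}"

definition lines_along ::
    "'s set \<Rightarrow> ('s \<Rightarrow> real ^ 'd) \<Rightarrow> 'd::finite \<Rightarrow> (real ^ 'd) set set" where
  "lines_along S y j = {L. axis_parallel_line j L \<and> sensors_on S y L \<noteq> {}}"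

text \<open>Distinct sensors at the same position count as consecutive, at distance \<open>0\<close>.\<close>

definition consecutive_on ::
    "'s set \<Rightarrow> ('s \<Rightarrow> 'v::real_vector) \<Rightarrow> 'v set \<Rightarrow> 's \<Rightarrow> 's \<Rightarrow> bool" where
  "consecutive_on S y L i k \<longleftrightarrow>
     i \<in> sensors_on S y L \<and> k \<in> sensors_on S y L \<and> i \<noteq> k \<and>
     \<not> (\<exists>l \<in> sensors_on S y L. y l \<in> open_segment (y i) (y k))"

definition admissible ::
    "nat \<Rightarrow> real \<Rightarrow> real \<Rightarrow> (('d::finite \<Rightarrow> nat) \<Rightarrow> real ^ 'd) \<Rightarrow> bool" where
  "admissible m s v y \<longleftrightarrow>
     (\<forall>j. card (lines_along (sensors m) y j) = m ^ (CARD('d) - 1) \<and>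
        (\<forall>L \<in> lines_along (sensors m) y j.
           card (sensors_on (sensors m) y L) = m \<and>
           (\<forall>i k. consecutive_on (sensors m) y L i k \<longrightarrow>
              s \<le> dist (y i) (y k) \<and> dist (y i) (y k) \<le> v)))"


section \<open>Movement\<close>

text \<open>
  \<open>D i $ j\<close> is the signed length of the movement of sensor \<open>i\<close> along the \<open>j\<close>-th coordinate axis;
  sensors move along the axes only, so these numbers describe the movement completely.
\<close>

definition total_movement ::
    "real \<Rightarrow> 's set \<Rightarrow> ('s \<Rightarrow> real ^ 'd::finite) \<Rightarrow> real" where
  "total_movement a S D = (\<Sum>i\<in>S. \<Sum>j\<in>UNIV. \<bar>D i $ j\<bar> powr a)"

definition minimal_movement ::
    "real \<Rightarrow> real \<Rightarrow> real \<Rightarrow> nat \<Rightarrow> (('d::finite \<Rightarrow> nat) \<Rightarrow> real ^ 'd) \<Rightarrow> real" where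
  "minimal_movement a s v m x =
     (INF D \<in> {D. admissible m s v (\<lambda>i. x i + D i)}. total_movement a (sensors m) D)"

end

theory Submission
  imports Defs "HOL-Real_Asymp.Real_Asymp"
begin

text \<open>
  Upper bound: moving sensor \<open>i\<close> to the grid point with coordinates \<open>i j * s\<close> costs at most a
  constant in expectation per sensor and axis, because the first \<open>m\<close> arrival times of a process of
  rate \<open>m\<close> have \<open>a\<close>-th moments bounded uniformly in \<open>m\<close> (Chernoff bound for the Poisson
  distribution). Lower bound, valid for every \<open>a > 0\<close>: with probability at least \<open>1/2\<close> all sensors
  start with \<open>j\<close>-th coordinate in \<open>[0, 1 + \<epsilon>/4]\<close>. In an admissible configuration the sensors on a
  line are \<open>s\<close>-separated, and there are only \<open>m ^ (CARD('d) - 1)\<close> lines, so the strip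
  \<open>[- \<epsilon>/8, 1 + 3\<epsilon>/8]\<close> contains at most a fraction \<open>(1 + \<epsilon>/2) / (1 + \<epsilon>) + 1/m\<close> of the sensors;
  all others have moved by at least \<open>\<epsilon>/8\<close>. The minimal movement is an infimum of continuous
  functions of the initial positions, hence upper semicontinuous and measurable.
\<close>

section \<open>Lower tail of the Poisson distribution\<close>

text \<open>Since \<open>1 \<le> t\<close>, every \<open>t ^ k\<close> with \<open>k < m\<close> is
  at most \<open>t ^ m\<close>. With that factor pulled out, a partial sum of the exponential series
  at \<open>m\<close> remains, so the bound is \<open>exp m * t ^ m * exp (- m * t)\<close>.\<close>

lemma poisson_pmf_lower_tail:
  fixes t :: real and m :: nat
  assumes "1 \<le> t" "1 \<le> m"
  shows "measure_pmf.prob (poisson_pmf (real m * t)) {..<m} \<le> exp (- real m * (t - 1 - ln t))"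
proof -
  have pos: "0 < real m * t" using assms by simp
  have "measure_pmf.prob (poisson_pmf (real m * t)) {..<m}
      = (\<Sum>k<m. (real m * t) ^ k / fact k * exp (- (real m * t)))"
    using pos by (simp add: measure_measure_pmf_finite)
  also have "\<dots> \<le> (\<Sum>k<m. (real m ^ k / fact k) * (t ^ m * exp (- (real m * t))))"
  proof (rule sum_mono)
    fix k assume "k \<in> {..<m}"
    then have "t ^ k \<le> t ^ m" using assms by (intro power_increasing) auto
    then have "real m ^ k / fact k * t ^ k * exp (- (real m * t))
        \<le> real m ^ k / fact k * t ^ m * exp (- (real m * t))"
      by (intro mult_right_mono mult_left_mono) auto
    then show "(real m * t) ^ k / fact k * exp (- (real m * t))
        \<le> (real m ^ k / fact k) * (t ^ m * exp (- (real m * t)))"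
      by (simp add: power_mult_distrib mult_ac)
  qed
  also have "\<dots> = (\<Sum>k<m. real m ^ k / fact k) * (t ^ m * exp (- (real m * t)))"
    by (simp add: sum_distrib_right)
  also have "\<dots> \<le> exp (real m) * (t ^ m * exp (- (real m * t)))"
  proof (rule mult_right_mono)
    have "(\<Sum>k<m. real m ^ k /\<^sub>R fact k) \<le> (\<Sum>k. real m ^ k /\<^sub>R fact k)"
      by (rule sum_le_suminf) (use summable_exp_generic[of "real m"] in auto)
    then show "(\<Sum>k<m. real m ^ k / fact k) \<le> exp (real m)"
      by (simp add: exp_def divide_inverse mult.commute)
  qed (use assms in auto)
  also have "t ^ m = exp (real m * ln t)"
    using assms by (simp add: exp_of_nat_mult)
  finally show ?thesis
    by (simp flip: exp_add add: algebra_simps)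
qed

section \<open>Arrival times of a single Poisson process\<close>

context
  fixes M :: "'w measure" and rate :: real and N :: "real \<Rightarrow> 'w \<Rightarrow> nat"
  assumes poisson: "poisson_process M rate N"
begin

lemma poisson_process_prob_space: "prob_space M"
  using poisson unfolding poisson_process_def by blast

lemma poisson_process_measurable: "0 \<le> t \<Longrightarrow> N t \<in> measurable M (count_space UNIV)"
  using poisson unfolding poisson_process_def by blast

lemma poisson_process_mono: "\<omega> \<in> space M \<Longrightarrow> 0 \<le> r \<Longrightarrow> r \<le> t \<Longrightarrow> N r \<omega> \<le> N t \<omega>"
  using poisson unfolding poisson_process_def mono_on_def by auto

lemma poisson_process_distr:
  assumes "0 < t"
  shows "distr M (count_space UNIV) (N t) = measure_pmf (poisson_pmf (rate * t))"
proof -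
  have "distr M (count_space UNIV) (\<lambda>\<omega>. N t \<omega> - N 0 \<omega>) = measure_pmf (poisson_pmf (rate * t))"
    using poisson assms unfolding poisson_process_def by (metis diff_zero order_refl)
  moreover have "distr M (count_space UNIV) (\<lambda>\<omega>. N t \<omega> - N 0 \<omega>) = distr M (count_space UNIV) (N t)"
    using poisson unfolding poisson_process_def by (intro distr_cong) auto
  ultimately show ?thesis by simp
qed

lemma arrival_time_bounds:
  assumes "0 \<le> t" "k \<le> N t \<omega>"
  shows "0 \<le> arrival_time N k \<omega>" "arrival_time N k \<omega> \<le> t"
  unfolding arrival_time_def using assms
  by (auto intro!: cInf_greatest cInf_lower bdd_belowI[of _ 0])

text \<open>The infimum runs over uncountably many times. Because the paths are monotone, rational
  times suffice to decide whether it is below \<open>c\<close>, and this leaves a countable union of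
  measurable events.\<close>

lemma borel_measurable_arrival_time: "arrival_time N k \<in> borel_measurable M"
proof -
  have [measurable]: "N (real n) \<in> measurable M (count_space UNIV)" for n
    by (rule poisson_process_measurable) simp
  have [measurable]: "N \<bar>q\<bar> \<in> measurable M (count_space UNIV)" for q
    by (rule poisson_process_measurable) simp
  \<comment> \<open>Integer times decide whether the count ever reaches \<open>k\<close>; if it does
    not, the arrival time is the constant \<open>Inf {}\<close>. Taking \<open>\<bar>q\<bar>\<close>
    keeps all times nonnegative, where \<open>N\<close> is known to be measurable.\<close>
  have eq: "arrival_time N k \<omega> < c \<longleftrightarrow>
      (if \<exists>n. k \<le> N (real n) \<omega> then \<exists>q::rat. \<bar>real_of_rat q\<bar> < c \<and> k \<le> N \<bar>real_of_rat q\<bar> \<omega>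
       else Inf {} < c)"
    if \<omega>: "\<omega> \<in> space M" for \<omega> c
  proof (cases "\<exists>n. k \<le> N (real n) \<omega>")
    case True
    then obtain n where n: "k \<le> N (real n) \<omega>" by blast
    have "arrival_time N k \<omega> < c \<longleftrightarrow> (\<exists>q::rat. \<bar>real_of_rat q\<bar> < c \<and> k \<le> N \<bar>real_of_rat q\<bar> \<omega>)"
    proof
      assume "arrival_time N k \<omega> < c"
      then obtain r where r: "0 \<le> r" "k \<le> N r \<omega>" "r < c"
        unfolding arrival_time_def using n
        by (subst (asm) cInf_less_iff) (auto intro!: bdd_belowI[of _ 0] exI[of _ "real n"])
      obtain q where "r < real_of_rat q" "real_of_rat q < c"
        using of_rat_dense[OF r(3)] by blast
      then show "\<exists>q::rat. \<bar>real_of_rat q\<bar> < c \<and> k \<le> N \<bar>real_of_rat q\<bar> \<omega>"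
      proof (intro exI[of _ q])
        have "\<bar>real_of_rat q\<bar> = real_of_rat q"
          using \<open>r < real_of_rat q\<close> r(1) by (intro abs_of_nonneg) linarith
        moreover have "N r \<omega> \<le> N (real_of_rat q) \<omega>"
          using \<open>r < real_of_rat q\<close> by (intro poisson_process_mono[OF \<omega> r(1)]) linarith
        ultimately show "\<bar>real_of_rat q\<bar> < c \<and> k \<le> N \<bar>real_of_rat q\<bar> \<omega>"
          using \<open>real_of_rat q < c\<close> r(2) by (simp only: le_trans simp_thms)
      qed
    qed (use arrival_time_bounds(2) abs_ge_zero in \<open>meson le_less_trans\<close>)
    then show ?thesis using True by simp
  next
    case False
    then have "\<not> k \<le> N t \<omega>" if "0 \<le> t" for t
      using poisson_process_mono[OF \<omega> that, of "real (nat \<lceil>t\<rceil>)"]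
      by (meson le_trans real_nat_ceiling_ge)
    then have "arrival_time N k \<omega> = Inf {}"
      unfolding arrival_time_def by (intro arg_cong[where f = Inf]) auto
    then show ?thesis using False by simp
  qed
  show ?thesis
    unfolding borel_measurable_iff_less
  proof
    fix c
    have "{\<omega> \<in> space M. arrival_time N k \<omega> < c} = {\<omega> \<in> space M. if \<exists>n. k \<le> N (real n) \<omega>
        then \<exists>q::rat. \<bar>real_of_rat q\<bar> < c \<and> k \<le> N \<bar>real_of_rat q\<bar> \<omega> else Inf {} < c}"
      using eq by blast
    also have "\<dots> \<in> sets M" by measurable
    finally show "{\<omega> \<in> space M. arrival_time N k \<omega> < c} \<in> sets M" .
  qed
qed

lemma poisson_process_lower_tail:
  assumes "rate = real m" "1 \<le> m" "1 \<le> t"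
  shows "measure M {\<omega> \<in> space M. N t \<omega> < m} \<le> exp (- real m * (t - 1 - ln t))"
proof -
  have "measure M {\<omega> \<in> space M. N t \<omega> < m} = measure (distr M (count_space UNIV) (N t)) {..<m}"
    using assms poisson_process_measurable[of t]
    by (subst measure_distr) (auto intro!: arg_cong[where f = "measure M"])
  also have "\<dots> \<le> exp (- real m * (t - 1 - ln t))"
    using assms poisson_pmf_lower_tail[of t m] poisson_process_distr[of t] by simp
  finally show ?thesis .
qed

text \<open>A weaker tail bound that no longer depends on \<open>m\<close> or \<open>k\<close> and
  holds for all \<open>t \<ge> 0\<close>: for \<open>t < 2\<close> the right-hand side exceeds 1. It
  decays fast enough to be summed against powers of \<open>t\<close>.\<close>

lemma poisson_process_lower_tail':
  assumes "rate = real m" "1 \<le> m" "k \<le> m" "0 \<le> t"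
  shows "emeasure M {\<omega> \<in> space M. N t \<omega> < k} \<le> ennreal (exp (1 - t / 2))"
proof -
  interpret prob_space M by (rule poisson_process_prob_space)
  have [measurable]: "N t \<in> measurable M (count_space UNIV)"
    by (rule poisson_process_measurable) fact
  have "prob {\<omega> \<in> space M. N t \<omega> < k} \<le> exp (1 - t / 2)"
  proof (cases "t < 2")
    case True
    then have "1 \<le> exp (1 - t / 2)" by simp
    then show ?thesis using prob_le_1 order_trans by blast
  next
    case False
    have "prob {\<omega> \<in> space M. N t \<omega> < k} \<le> prob {\<omega> \<in> space M. N t \<omega> < m}"
      using assms by (intro finite_measure_mono) auto
    also have "\<dots> \<le> exp (- real m * (t - 1 - ln t))"
      using poisson_process_lower_tail[of m t] assms False by simp
    also have "\<dots> \<le> exp (1 - t / 2)"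
    proof -
      \<comment> \<open>Splitting \<open>ln t = ln (t / 2) + ln 2\<close> and bounding both terms
        gives \<open>ln t \<le> t / 2\<close>. The factor \<open>m\<close> can then be dropped
        because \<open>t / 2 - 1 \<ge> 0\<close> and \<open>m \<ge> 1\<close>.\<close>
      have "ln (t / 2) \<le> t / 2 - 1" using False by (intro ln_le_minus_one) simp
      moreover have "ln (2::real) \<le> 1" using ln_le_minus_one[of 2] by simp
      ultimately have "t / 2 - 1 \<le> t - 1 - ln t" using False by (simp add: ln_div)
      moreover have "1 * (t / 2 - 1) \<le> real m * (t / 2 - 1)"
        using assms False by (intro mult_right_mono) auto
      ultimately have "t / 2 - 1 \<le> real m * (t - 1 - ln t)"
        using mult_left_mono[of "t / 2 - 1" "t - 1 - ln t" "real m"] by simp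
      then show ?thesis by simp
    qed
    finally show ?thesis .
  qed
  then show ?thesis by (simp add: emeasure_eq_measure)
qed

text \<open>
  If the count never reaches \<open>k\<close>, the arrival time is the junk value \<open>Inf {}\<close>, but then the right-hand
  side is infinite; so no almost-sure finiteness is needed.
\<close>

lemma powr_arrival_time_le:
  assumes "0 < a"
  shows "ennreal (\<bar>arrival_time N k \<omega>\<bar> powr a)
    \<le> (\<Sum>n. ennreal ((real n + 1) powr a) * indicator {\<omega>. N (real n) \<omega> < k} \<omega>)"
    (is "_ \<le> (\<Sum>n. ?f n)")
proof (cases "\<exists>n. k \<le> N (real n) \<omega>")
  case True
  \<comment> \<open>The first integer time at which the count has reached \<open>k\<close>. If it is
    \<open>l + 1\<close>, the arrival time is at most \<open>l + 1\<close> and the term of index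
    \<open>l\<close> alone dominates; if it is 0, the arrival time is 0.\<close>
  define n where "n = (LEAST n. k \<le> N (real n) \<omega>)"
  have n: "k \<le> N (real n) \<omega>" unfolding n_def using True by (rule LeastI_ex)
  note bounds = arrival_time_bounds[OF of_nat_0_le_iff n]
  show ?thesis
  proof (cases n)
    case 0
    then show ?thesis using bounds by simp
  next
    case (Suc l)
    then have l: "N (real l) \<omega> < k"
      using not_less_Least[of l "\<lambda>n. k \<le> N (real n) \<omega>"] by (simp add: n_def)
    have "ennreal (\<bar>arrival_time N k \<omega>\<bar> powr a) \<le> ennreal ((real l + 1) powr a)"
      using bounds Suc assms by (intro ennreal_leI powr_mono2) auto
    also have "\<dots> = (\<Sum>n\<in>{l}. ?f n)" using l by simp
    also have "\<dots> \<le> (\<Sum>n. ?f n)" by (rule sum_le_suminf) auto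
    finally show ?thesis .
  qed
next
  case False
  have "(\<Sum>n. ?f n) = top"
  proof (rule ccontr)
    assume "(\<Sum>n. ?f n) \<noteq> top"
    then obtain r where r: "(\<Sum>n. ?f n) < of_nat r"
      using ennreal_Ex_less_of_nat top.not_eq_extremum by blast
    have "of_nat r = (\<Sum>n<r. (1::ennreal))" by simp
    also have "\<dots> \<le> (\<Sum>n<r. ?f n)"
    proof (rule sum_mono)
      fix n
      have "1 \<le> (real n + 1) powr a" using assms by (intro ge_one_powr_ge_zero) auto
      then show "1 \<le> ?f n" using False by (simp add: not_le)
    qed
    also have "\<dots> \<le> (\<Sum>n. ?f n)" by (rule sum_le_suminf) auto
    finally show False using r by simp
  qed
  then show ?thesis by simp
qed

end

section \<open>Moments of arrival times, uniformly in the rate\<close>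

lemma summable_powr_exp: "summable (\<lambda>n. (real n + 1) powr a * exp (1 - real n / 2))"
proof (rule summable_comparison_test_bigo)
  show "summable (\<lambda>n. norm (1 / real n ^ 2))"
    using inverse_power_summable[of 2, where 'a = real] by (simp add: divide_inverse)
  show "(\<lambda>n. (real n + 1) powr a * exp (1 - real n / 2)) \<in> O(\<lambda>n. 1 / real n ^ 2)"
    by real_asymp
qed

text \<open>The series obtained by cutting the half-line at the integers: weight
  \<open>(n + 1) powr a\<close> times the uniform tail bound at time \<open>n\<close>. It depends on
  \<open>a\<close> only, which makes the final constants independent of \<open>m\<close>.\<close>

definition moment_bound :: "real \<Rightarrow> real" where
  "moment_bound a = (\<Sum>n. (real n + 1) powr a * exp (1 - real n / 2))"

lemma moment_bound_nonneg: "0 \<le> moment_bound a"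
  unfolding moment_bound_def by (intro suminf_nonneg summable_powr_exp) auto

text \<open>The pointwise series bound is integrated term by term, and each event probability is
  replaced by its uniform tail bound. Working with the nonnegative integral first yields
  integrability and the estimate together.\<close>

lemma arrival_time_moment:
  assumes "poisson_process M (real m) N" "1 \<le> m" "k \<le> m" "0 < a"
  shows "integrable M (\<lambda>\<omega>. \<bar>arrival_time N k \<omega>\<bar> powr a)"
    and "(\<integral>\<omega>. \<bar>arrival_time N k \<omega>\<bar> powr a \<partial>M) \<le> moment_bound a"
proof -
  note [measurable] = borel_measurable_arrival_time[OF assms(1)]
  have [measurable]: "N (real n) \<in> measurable M (count_space UNIV)" for n
    by (rule poisson_process_measurable[OF assms(1)]) simp
  have "(\<integral>\<^sup>+\<omega>. \<bar>arrival_time N k \<omega>\<bar> powr a \<partial>M)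
    \<le> (\<integral>\<^sup>+\<omega>. (\<Sum>n. ennreal ((real n + 1) powr a) * indicator {\<omega>. N (real n) \<omega> < k} \<omega>) \<partial>M)"
    by (intro nn_integral_mono powr_arrival_time_le[OF assms(1,4)])
  also have "\<dots> = (\<integral>\<^sup>+\<omega>. (\<Sum>n. ennreal ((real n + 1) powr a) *
      indicator {\<omega> \<in> space M. N (real n) \<omega> < k} \<omega>) \<partial>M)"
    by (intro nn_integral_cong) (simp add: indicator_def)
  also have "\<dots> = (\<Sum>n. \<integral>\<^sup>+\<omega>. ennreal ((real n + 1) powr a) *
      indicator {\<omega> \<in> space M. N (real n) \<omega> < k} \<omega> \<partial>M)"
    by (rule nn_integral_suminf) measurable
  also have "\<dots> = (\<Sum>n. ennreal ((real n + 1) powr a) * emeasure M {\<omega> \<in> space M. N (real n) \<omega> < k})"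
    by (intro suminf_cong nn_integral_cmult_indicator) measurable
  also have "\<dots> \<le> (\<Sum>n. ennreal ((real n + 1) powr a) * ennreal (exp (1 - real n / 2)))"
    by (intro suminf_le mult_left_mono poisson_process_lower_tail'[OF assms(1) refl assms(2,3)]) auto
  also have "\<dots> = ennreal (moment_bound a)"
    unfolding moment_bound_def
    by (simp add: suminf_ennreal2[OF _ summable_powr_exp] flip: ennreal_mult)
  finally have le: "(\<integral>\<^sup>+\<omega>. \<bar>arrival_time N k \<omega>\<bar> powr a \<partial>M) \<le> ennreal (moment_bound a)" .
  then have "(\<integral>\<^sup>+\<omega>. \<bar>arrival_time N k \<omega>\<bar> powr a \<partial>M) < \<infinity>"
    by (simp add: le_less_trans)
  then show "integrable M (\<lambda>\<omega>. \<bar>arrival_time N k \<omega>\<bar> powr a)"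
    by (intro integrableI_nonneg) auto
  show "(\<integral>\<omega>. \<bar>arrival_time N k \<omega>\<bar> powr a \<partial>M) \<le> moment_bound a"
    by (rule integral_real_bounded[OF moment_bound_nonneg le])
qed

section \<open>Counting separated sensors in a strip\<close>

text \<open>Pigeonhole: the half-open cells of width \<open>s\<close> starting at \<open>l\<close>
  contain at most one point each, and \<open>?g\<close> is the number of the cell.\<close>

lemma card_separated_le:
  fixes f :: "'s \<Rightarrow> real"
  assumes "0 < s" "l \<le> u"
    and sep: "\<And>i k. i \<in> A \<Longrightarrow> k \<in> A \<Longrightarrow> i \<noteq> k \<Longrightarrow> s \<le> \<bar>f i - f k\<bar>"
    and bounds: "\<And>i. i \<in> A \<Longrightarrow> l \<le> f i \<and> f i \<le> u"
  shows "real (card A) \<le> (u - l) / s + 1"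
proof -
  let ?g = "\<lambda>i. \<lfloor>(f i - l) / s\<rfloor>"
  have "inj_on ?g A"
  proof (rule inj_onI, rule ccontr)
    fix i k assume ik: "i \<in> A" "k \<in> A" "?g i = ?g k" "i \<noteq> k"
    have "\<bar>(f i - l) / s - (f k - l) / s\<bar> < 1" using ik(3) by linarith
    moreover have "(f i - l) / s - (f k - l) / s = (f i - f k) / s" by (simp add: diff_divide_distrib)
    ultimately have "\<bar>f i - f k\<bar> < s" using assms(1) by (simp add: abs_divide)
    then show False using sep[OF ik(1,2,4)] by simp
  qed
  moreover have "?g ` A \<subseteq> {0..\<lfloor>(u - l) / s\<rfloor>}"
    using bounds assms(1) by (auto intro!: floor_mono divide_right_mono)
  ultimately have "card A \<le> card {0..\<lfloor>(u - l) / s\<rfloor>}" by (metis card_inj_on_le finite_atLeastAtMost_int)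
  moreover have "0 \<le> \<lfloor>(u - l) / s\<rfloor>" using assms by simp
  ultimately have "real (card A) \<le> of_int \<lfloor>(u - l) / s\<rfloor> + 1" by simp linarith
  then show ?thesis by linarith
qed

text \<open>A closest pair of distinct sensors is consecutive, since a sensor strictly between the
  two would be closer to the first. So the bound for consecutive pairs holds for the minimal
  distance. This also covers coinciding sensors, whose open segment is empty.\<close>

lemma separated_if_consecutive_separated:
  fixes y :: "'s \<Rightarrow> 'v::euclidean_space"
  assumes "finite S"
    and sep: "\<And>i k. consecutive_on S y L i k \<Longrightarrow> s \<le> dist (y i) (y k)"
    and ik: "i \<in> sensors_on S y L" "k \<in> sensors_on S y L" "i \<noteq> k"
  shows "s \<le> dist (y i) (y k)"
proof -
  let ?T = "sensors_on S y L"
  let ?P = "{p \<in> ?T \<times> ?T. fst p \<noteq> snd p}"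
  let ?d = "\<lambda>p. dist (y (fst p)) (y (snd p))"
  have "finite ?T" using assms(1) by (simp add: sensors_on_def)
  then have "finite ?P" by auto
  moreover have "(i, k) \<in> ?P" using ik by simp
  then have "?P \<noteq> {}" by blast
  ultimately obtain p where p: "p \<in> ?P" "\<And>q. q \<in> ?P \<Longrightarrow> ?d p \<le> ?d q"
    using that[OF arg_min_if_finite(1) arg_min_least] by (simp only: simp_thms)
  have "consecutive_on S y L (fst p) (snd p)"
  proof -
    have False if l: "l \<in> ?T" "y l \<in> open_segment (y (fst p)) (y (snd p))" for l
    proof -
      have "?d (fst p, l) < ?d p"
        using dist_in_open_segment[OF l(2)] by (auto simp: dist_commute)
      moreover have "(fst p, l) \<in> ?P" using p(1) l by (auto simp: open_segment_def)
      ultimately show False using p(2) by force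
    qed
    then show ?thesis using p(1) by (auto simp: consecutive_on_def)
  qed
  then have "s \<le> ?d p" by (rule sep)
  also have "\<dots> \<le> ?d (i, k)" by (rule p(2)) fact
  finally show ?thesis by simp
qed

lemma mem_axis_line_iff:
  fixes p z :: "real ^ 'd::finite"
  shows "z \<in> range (\<lambda>t. p + t *\<^sub>R axis j 1) \<longleftrightarrow> (\<forall>k. k \<noteq> j \<longrightarrow> z $ k = p $ k)"
proof
  assume "\<forall>k. k \<noteq> j \<longrightarrow> z $ k = p $ k"
  then have "z = p + (z $ j - p $ j) *\<^sub>R axis j 1"
    by (simp add: vec_eq_iff axis_def)
  then show "z \<in> range (\<lambda>t. p + t *\<^sub>R axis j 1)" by blast
qed (auto simp: axis_def)

lemma dist_axis_line:
  fixes y z :: "real ^ 'd::finite"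
  assumes "\<And>k. k \<noteq> j \<Longrightarrow> y $ k = z $ k"
  shows "dist y z = \<bar>y $ j - z $ j\<bar>"
proof -
  have "y - z = (y $ j - z $ j) *\<^sub>R axis j 1"
    using assms by (simp add: vec_eq_iff axis_def)
  then show ?thesis by (metis dist_norm norm_scaleR norm_axis_1 mult.right_neutral)
qed

lemma finite_sensors: "finite (sensors m :: ('d::finite \<Rightarrow> nat) set)"
  unfolding sensors_def by (intro finite_PiE) auto

lemma card_sensors: "card (sensors m :: ('d::finite \<Rightarrow> nat) set) = m ^ CARD('d)"
  unfolding sensors_def by (subst card_PiE) auto

text \<open>Every sensor lies on the line in direction \<open>j\<close> through its position. Along
  such a line distances are differences of \<open>j\<close>-th coordinates, so the one-dimensional
  count applies to each of the \<open>m ^ (CARD('d) - 1)\<close> lines.\<close>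

lemma admissible_card_strip_le:
  fixes y :: "('d::finite \<Rightarrow> nat) \<Rightarrow> real ^ 'd"
  assumes adm: "admissible m s v y" and "0 < s" "1 \<le> m" "l \<le> u"
  shows "real (card {i \<in> sensors m. l \<le> y i $ j \<and> y i $ j \<le> u})
    \<le> real m ^ (CARD('d) - 1) * ((u - l) / s + 1)"
proof -
  let ?Ls = "lines_along (sensors m) y j"
  let ?B = "\<lambda>L. {i \<in> sensors_on (sensors m) y L. l \<le> y i $ j \<and> y i $ j \<le> u}"
  have cLs: "card ?Ls = m ^ (CARD('d) - 1)" using adm by (simp add: admissible_def)
  \<comment> \<open>An infinite set has cardinality 0, but this cardinality is positive because
    \<open>m \<ge> 1\<close>.\<close>
  then have fin: "finite ?Ls" using assms(3) card.infinite by fastforce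
  have B: "real (card (?B L)) \<le> (u - l) / s + 1" if L: "L \<in> ?Ls" for L
  proof (rule card_separated_le[OF assms(2,4)])
    fix i k assume ik: "i \<in> ?B L" "k \<in> ?B L" "i \<noteq> k"
    have "s \<le> dist (y i) (y k)"
    proof (rule separated_if_consecutive_separated[OF finite_sensors])
      show "s \<le> dist (y i) (y k)" if "consecutive_on (sensors m) y L i k" for i k
        using adm L that unfolding admissible_def by blast
    qed (use ik in simp_all)
    moreover obtain p where p: "L = range (\<lambda>t. p + t *\<^sub>R axis j 1)"
      using L by (auto simp: lines_along_def axis_parallel_line_def)
    have "y i \<in> L" "y k \<in> L" using ik by (auto simp: sensors_on_def)
    then have "dist (y i) (y k) = \<bar>y i $ j - y k $ j\<bar>"
      unfolding p mem_axis_line_iff by (intro dist_axis_line) auto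
    ultimately show "s \<le> \<bar>y i $ j - y k $ j\<bar>" by simp
  qed auto
  have "{i \<in> sensors m. l \<le> y i $ j \<and> y i $ j \<le> u} \<subseteq> (\<Union>L\<in>?Ls. ?B L)"
  proof
    fix i assume i: "i \<in> {i \<in> sensors m. l \<le> y i $ j \<and> y i $ j \<le> u}"
    let ?L = "range (\<lambda>t. y i + t *\<^sub>R axis j 1)"
    have "y i \<in> ?L" unfolding mem_axis_line_iff by simp
    then have "i \<in> ?B ?L" using i by (simp add: sensors_on_def)
    moreover from this have "?L \<in> ?Ls"
      unfolding lines_along_def axis_parallel_line_def by blast
    ultimately show "i \<in> (\<Union>L\<in>?Ls. ?B L)" by blast
  qed
  then have "card {i \<in> sensors m. l \<le> y i $ j \<and> y i $ j \<le> u} \<le> card (\<Union>L\<in>?Ls. ?B L)"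
    by (intro card_mono finite_UN_I fin) (auto simp: sensors_on_def finite_sensors)
  also have "\<dots> \<le> (\<Sum>L\<in>?Ls. card (?B L))" by (rule card_UN_le[OF fin])
  finally have "real (card {i \<in> sensors m. l \<le> y i $ j \<and> y i $ j \<le> u}) \<le> (\<Sum>L\<in>?Ls. real (card (?B L)))"
    by (simp only: of_nat_le_iff flip: of_nat_sum)
  also have "\<dots> \<le> (\<Sum>L\<in>?Ls. (u - l) / s + 1)" by (rule sum_mono) (rule B)
  finally show ?thesis by (simp add: cLs)
qed

text \<open>A sensor that starts with \<open>j\<close>-th coordinate in \<open>[0, t]\<close> and
  ends outside the strip widened by \<open>\<eta>\<close> on both sides has moved at least
  \<open>\<eta>\<close> along axis \<open>j\<close>. The strip count bounds the number of sensors
  that end inside.\<close>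

lemma admissible_movement_ge:
  fixes x y :: "('d::finite \<Rightarrow> nat) \<Rightarrow> real ^ 'd"
  assumes adm: "admissible m s v y" and "0 < s" "1 \<le> m" "0 \<le> t" "0 < \<eta>" "0 < a"
    and x: "\<And>i. i \<in> sensors m \<Longrightarrow> 0 \<le> x i $ j \<and> x i $ j \<le> t"
  shows "(real m ^ CARD('d) - real m ^ (CARD('d) - 1) * ((t + 2 * \<eta>) / s + 1)) * \<eta> powr a
    \<le> total_movement a (sensors m) (\<lambda>i. y i - x i)"
proof -
  let ?B = "{i \<in> sensors m. - \<eta> \<le> y i $ j \<and> y i $ j \<le> t + \<eta>}"
  let ?f = "\<lambda>i. \<Sum>j\<in>UNIV. \<bar>(y i - x i) $ j\<bar> powr a"
  have eq: "t + \<eta> - - \<eta> = t + 2 * \<eta>" by simp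
  have "real (card ?B) \<le> real m ^ (CARD('d) - 1) * ((t + 2 * \<eta>) / s + 1)"
    using admissible_card_strip_le[OF adm assms(2,3), of "- \<eta>" "t + \<eta>" j] assms(4,5)
    unfolding eq by linarith
  moreover have "card (sensors m - ?B) = card (sensors m :: ('d \<Rightarrow> nat) set) - card ?B"
    by (intro card_Diff_subset) (auto simp: finite_sensors)
  \<comment> \<open>This makes the truncated subtraction of cardinalities exact when it is cast to
    the reals.\<close>
  moreover have "card ?B \<le> card (sensors m :: ('d \<Rightarrow> nat) set)"
    by (intro card_mono) (auto simp: finite_sensors)
  ultimately have "real m ^ CARD('d) - real m ^ (CARD('d) - 1) * ((t + 2 * \<eta>) / s + 1)
      \<le> real (card (sensors m - ?B))"
    by (simp add: card_sensors)
  then have "(real m ^ CARD('d) - real m ^ (CARD('d) - 1) * ((t + 2 * \<eta>) / s + 1)) * \<eta> powr a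
      \<le> real (card (sensors m - ?B)) * \<eta> powr a"
    by (rule mult_right_mono) simp
  also have "\<dots> = (\<Sum>i\<in>sensors m - ?B. \<eta> powr a)" by simp
  also have "\<dots> \<le> (\<Sum>i\<in>sensors m - ?B. ?f i)"
  proof (rule sum_mono)
    fix i assume i: "i \<in> sensors m - ?B"
    have "\<eta> powr a \<le> \<bar>(y i - x i) $ j\<bar> powr a"
    proof (rule powr_mono2)
      have "y i $ j < - \<eta> \<or> t + \<eta> < y i $ j" "0 \<le> x i $ j" "x i $ j \<le> t"
        using i x[of i] by auto
      then show "\<eta> \<le> \<bar>(y i - x i) $ j\<bar>" by auto
    qed (use assms in auto)
    also have "\<dots> \<le> ?f i" by (intro member_le_sum) auto
    finally show "\<eta> powr a \<le> ?f i" .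
  qed
  also have "\<dots> \<le> (\<Sum>i\<in>sensors m. ?f i)"
    by (intro sum_mono2 finite_sensors sum_nonneg) auto
  finally show ?thesis by (simp add: total_movement_def)
qed

section \<open>Admissibility of the regular grid\<close>

text \<open>The grid is the target configuration for the upper bound, and it shows that the infimum
  defining the minimal movement ranges over a nonempty set. Consecutive sensors on its lines are
  exactly \<open>s\<close> apart.\<close>

lemma admissible_grid:
  assumes "0 < s" "s \<le> v" "1 \<le> m"
  shows "admissible m s v (\<lambda>i :: 'd::finite \<Rightarrow> nat. \<chi> j. real (i j) * s)"
proof -
  define y where "y = (\<lambda>i :: 'd \<Rightarrow> nat. \<chi> j. real (i j) * s)"
  have y_nth [simp]: "y i $ j = real (i j) * s" for i j by (simp add: y_def)
  have "card (lines_along (sensors m) y j) = m ^ (CARD('d) - 1) \<and>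
      (\<forall>L \<in> lines_along (sensors m) y j. card (sensors_on (sensors m) y L) = m \<and>
        (\<forall>i k. consecutive_on (sensors m) y L i k \<longrightarrow>
          s \<le> dist (y i) (y k) \<and> dist (y i) (y k) \<le> v))" for j
  proof -
    define line where "line f = range (\<lambda>t. y f + t *\<^sub>R axis j 1)" for f
    have y_line: "y i \<in> line f \<longleftrightarrow> (\<forall>k. k \<noteq> j \<longrightarrow> i k = f k)" for i f
      unfolding line_def mem_axis_line_iff using assms by simp
    \<comment> \<open>Lines in direction \<open>j\<close> are indexed by the coordinates other than
      \<open>j\<close>. The value of \<open>f\<close> at \<open>j\<close> is
      \<open>undefined\<close>, which only shifts the base point along the line; fixing it makes the
      index unique.\<close>
    let ?F = "PiE (UNIV - {j}) (\<lambda>_. {1..m})"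
    have on: "sensors_on (sensors m) y (line f) = (\<lambda>c. f(j := c)) ` {1..m}"
      if f: "f \<in> ?F" for f
    proof (intro equalityI subsetI)
      fix i assume "i \<in> sensors_on (sensors m) y (line f)"
      then have i: "i \<in> sensors m" "\<forall>k. k \<noteq> j \<longrightarrow> i k = f k"
        by (auto simp: sensors_on_def y_line)
      then have "i = f(j := i j)" "i j \<in> {1..m}" by (auto simp: sensors_def)
      then show "i \<in> (\<lambda>c. f(j := c)) ` {1..m}" by blast
    next
      fix i assume "i \<in> (\<lambda>c. f(j := c)) ` {1..m}"
      then show "i \<in> sensors_on (sensors m) y (line f)"
        using f by (auto simp: sensors_on_def y_line sensors_def PiE_def Pi_def)
    qed
    have lines: "lines_along (sensors m) y j = line ` ?F"
    proof (intro equalityI subsetI)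
      fix L assume "L \<in> lines_along (sensors m) y j"
      then obtain p i where p: "L = range (\<lambda>t. p + t *\<^sub>R axis j 1)" and i: "i \<in> sensors m" "y i \<in> L"
        by (auto simp: lines_along_def axis_parallel_line_def sensors_on_def)
      define f where "f = i(j := undefined)"
      have "f \<in> ?F" using i by (auto simp: f_def sensors_def PiE_def Pi_def extensional_def)
      moreover have "p $ k = y f $ k" if "k \<noteq> j" for k
        using i(2) that unfolding p mem_axis_line_iff by (simp add: f_def)
      then have "L = line f"
        by (intro set_eqI) (simp only: p line_def mem_axis_line_iff, metis)
      ultimately show "L \<in> line ` ?F" by blast
    next
      fix L assume "L \<in> line ` ?F"
      then obtain f where f: "f \<in> ?F" "L = line f" by blast
      then have "sensors_on (sensors m) y L \<noteq> {}" using on assms(3) by auto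
      moreover have "axis_parallel_line j L"
        unfolding f(2) line_def axis_parallel_line_def by blast
      ultimately show "L \<in> lines_along (sensors m) y j" by (simp add: lines_along_def)
    qed
    have "inj_on line ?F"
    proof (rule inj_onI)
      fix f g assume fg: "f \<in> ?F" "g \<in> ?F" "line f = line g"
      have "y f \<in> line g" using y_line[of f f] fg(3) by simp
      then have "\<forall>k. k \<noteq> j \<longrightarrow> f k = g k" by (simp add: y_line)
      then show "f = g" using fg(1,2) by (intro PiE_ext[of f _ _ g]) auto
    qed
    then have "card (lines_along (sensors m) y j) = m ^ (CARD('d) - 1)"
      by (simp add: lines card_image card_PiE)
    moreover have "card (sensors_on (sensors m) y L) = m \<and>
        (\<forall>i k. consecutive_on (sensors m) y L i k \<longrightarrow>
          s \<le> dist (y i) (y k) \<and> dist (y i) (y k) \<le> v)"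
      if L: "L \<in> lines_along (sensors m) y j" for L
    proof -
      obtain f where f: "f \<in> ?F" "L = line f" using L lines by blast
      note onL = on[OF f(1), folded f(2)]
      have "inj_on (\<lambda>c. f(j := c)) {1..m}" by (rule inj_onI) (metis fun_upd_same)
      then have "card (sensors_on (sensors m) y L) = m" by (simp add: onL card_image)
      moreover have succ: "c' = Suc c"
        if cons: "consecutive_on (sensors m) y L (f(j := c)) (f(j := c'))"
          and c: "c \<in> {1..m}" "c' \<in> {1..m}" "c < c'" for c c'
      proof (rule ccontr)
        assume "c' \<noteq> Suc c"
        then have c': "Suc c < c'" using c by simp
        \<comment> \<open>The convex coefficient that places \<open>Suc c\<close> between
          \<open>c\<close> and \<open>c'\<close>. The grid point with \<open>j\<close>-th index
          \<open>Suc c\<close> then contradicts consecutiveness.\<close>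
        define u where "u = 1 / (real c' - real c)"
        have u: "0 < u" "u < 1" using c' by (auto simp: u_def)
        have "u * (real c' - real c) = 1" using c by (simp add: u_def)
        then have "real (Suc c) = (1 - u) * real c + u * real c'" by (simp add: algebra_simps)
        then have "real (Suc c) * s = (1 - u) * (real c * s) + u * (real c' * s)"
          by (simp only:) (simp add: algebra_simps)
        then have "y (f(j := Suc c)) = (1 - u) *\<^sub>R y (f(j := c)) + u *\<^sub>R y (f(j := c'))"
          by (simp add: vec_eq_iff algebra_simps)
        moreover have "y (f(j := c)) \<noteq> y (f(j := c'))"
          using c assms by (auto simp: vec_eq_iff intro!: exI[of _ j])
        ultimately have "y (f(j := Suc c)) \<in> open_segment (y (f(j := c))) (y (f(j := c')))"
          using u by (auto simp: in_segment)
        moreover have "f(j := Suc c) \<in> sensors_on (sensors m) y L" using c c' by (auto simp: onL)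
        ultimately show False using cons by (auto simp: consecutive_on_def)
      qed
      have "dist (y i) (y k) = s" if ik: "consecutive_on (sensors m) y L i k" for i k
      proof -
        obtain c c' where c: "i = f(j := c)" "k = f(j := c')" "c \<in> {1..m}" "c' \<in> {1..m}" "c \<noteq> c'"
          using ik unfolding consecutive_on_def onL by blast
        have "consecutive_on (sensors m) y L k i"
          using ik by (auto simp: consecutive_on_def open_segment_commute)
        then have "c' = Suc c \<or> c = Suc c'"
          using succ[of c c'] succ[of c' c] ik c by (meson linorder_neqE_nat)
        moreover have "dist (y i) (y k) = \<bar>y i $ j - y k $ j\<bar>"
          by (intro dist_axis_line) (simp add: c)
        ultimately show ?thesis using assms by (auto simp: c algebra_simps)
      qed
      ultimately show ?thesis using assms by auto
    qed
    ultimately show ?thesis by blast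
  qed
  then show ?thesis unfolding admissible_def y_def by blast
qed


section \<open>The minimal movement as an infimum, and its measurability\<close>

lemma total_movement_nonneg: "0 \<le> total_movement a S D"
  unfolding total_movement_def by (intro sum_nonneg) auto

text \<open>Substituting \<open>y = x + D\<close> makes the index set of the infimum independent of
  the initial positions \<open>x\<close>, as the measurability argument requires.\<close>

lemma minimal_movement_eq:
  fixes x :: "('d::finite \<Rightarrow> nat) \<Rightarrow> real ^ 'd"
  shows "minimal_movement a s v m x
    = (INF y \<in> Collect (admissible m s v). total_movement a (sensors m) (\<lambda>i. y i - x i))"
proof -
  have "{D. admissible m s v (\<lambda>i. x i + D i)} = (\<lambda>y i. y i - x i) ` Collect (admissible m s v)"
  proof (intro equalityI subsetI)
    fix D assume "D \<in> {D. admissible m s v (\<lambda>i. x i + D i)}"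
    then show "D \<in> (\<lambda>y i. y i - x i) ` Collect (admissible m s v)"
      by (intro image_eqI[of _ _ "\<lambda>i. x i + D i"]) auto
  qed auto
  then show ?thesis by (simp add: minimal_movement_def image_image)
qed

lemma minimal_movement_le:
  assumes "admissible m s v y"
  shows "minimal_movement a s v m x \<le> total_movement a (sensors m) (\<lambda>i. y i - x i)"
  unfolding minimal_movement_eq using assms
  by (intro cINF_lower) (auto intro: bdd_belowI2[of _ 0] total_movement_nonneg)

text \<open>The witness \<open>y\<^sub>0\<close> rules out an infimum over the empty set.\<close>

lemma minimal_movement_ge:
  fixes x y\<^sub>0 :: "('d::finite \<Rightarrow> nat) \<Rightarrow> real ^ 'd"
  assumes "admissible m s v y\<^sub>0"
    and "\<And>y. admissible m s v y \<Longrightarrow> c \<le> total_movement a (sensors m) (\<lambda>i. y i - x i)"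
  shows "c \<le> minimal_movement a s v m x"
  unfolding minimal_movement_eq using assms by (intro cINF_greatest) auto

lemma borel_measurable_minimal_movement:
  fixes y\<^sub>0 :: "('d::finite \<Rightarrow> nat) \<Rightarrow> real ^ 'd"
  assumes adm: "admissible m s v y\<^sub>0" and "0 < a"
  shows "minimal_movement a s v m \<in>
    borel_measurable (borel :: (('d \<Rightarrow> nat) \<Rightarrow> real ^ 'd) measure)"
  unfolding borel_measurable_iff_less
proof
  fix c
  let ?f = "\<lambda>y x :: ('d \<Rightarrow> nat) \<Rightarrow> real ^ 'd. total_movement a (sensors m) (\<lambda>i. y i - x i)"
  \<comment> \<open>The power is continuous even where a displacement vanishes, because
    \<open>a > 0\<close>.\<close>
  have cont: "continuous_on UNIV (?f y)" for y
    unfolding total_movement_def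
    by (intro continuous_intros continuous_on_powr' continuous_on_product_coordinates) (use assms in auto)
  have "minimal_movement a s v m x < c \<longleftrightarrow> (\<exists>y\<in>Collect (admissible m s v). ?f y x < c)" for x
    unfolding minimal_movement_eq
    by (intro cINF_less_iff) (use adm in \<open>auto intro: bdd_belowI2[of _ 0] total_movement_nonneg\<close>)
  \<comment> \<open>The union is in general uncountable, so measurability comes from
    openness.\<close>
  then have "{x \<in> space borel. minimal_movement a s v m x < c}
      = (\<Union>y\<in>Collect (admissible m s v). {x. ?f y x < c})"
    by auto
  also have "open \<dots>"
    by (intro open_UN ballI open_Collect_less cont continuous_on_const)
  finally show "{x :: ('d \<Rightarrow> nat) \<Rightarrow> real ^ 'd \<in> space borel. minimal_movement a s v m x < c} \<in> sets borel"
    by (rule borel_open)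
qed

text \<open>The index type \<open>'d \<Rightarrow> nat\<close> is countable because
  \<open>'d\<close> is finite, so Borel measurability for the product topology can be checked
  coordinatewise.\<close>

lemma borel_measurable_initial_position:
  fixes N :: "'d::finite \<Rightarrow> real \<Rightarrow> 'w \<Rightarrow> nat"
  assumes "\<And>j. poisson_process M rate (N j)"
  shows "initial_position N \<in> borel_measurable M"
proof (rule measurable_coordinatewise_then_product)
  fix i :: "'d \<Rightarrow> nat"
  show "(\<lambda>\<omega>. initial_position N \<omega> i) \<in> borel_measurable M"
    unfolding borel_measurable_euclidean_space[of "\<lambda>\<omega>. initial_position N \<omega> i"]
  proof
    fix b :: "real ^ 'd" assume "b \<in> Basis"
    then obtain j where b: "b = axis j 1" by (auto simp: Basis_vec_def)
    then show "(\<lambda>\<omega>. initial_position N \<omega> i \<bullet> b) \<in> borel_measurable M"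
      using borel_measurable_arrival_time[OF assms] by (simp add: initial_position_def inner_axis)
  qed
qed

section \<open>Upper and lower bounds for the expected cost\<close>

text \<open>A substitute for the triangle inequality that treats convex and concave powers alike:
  the difference is at most twice the larger of \<open>c\<close> and
  \<open>\<bar>q\<bar>\<close>.\<close>

lemma powr_abs_diff_le:
  fixes p q c a :: real
  assumes "0 \<le> p" "p \<le> c" "0 < a"
  shows "\<bar>p - q\<bar> powr a \<le> 2 powr a * (c powr a + \<bar>q\<bar> powr a)"
proof -
  have "\<bar>p - q\<bar> powr a \<le> (2 * max c \<bar>q\<bar>) powr a"
    using assms by (intro powr_mono2) auto
  also have "\<dots> = 2 powr a * max c \<bar>q\<bar> powr a"
    using assms by (intro powr_mult)
  also have "\<dots> \<le> 2 powr a * (c powr a + \<bar>q\<bar> powr a)"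
    by (intro mult_left_mono) (auto simp: max_def)
  finally show ?thesis .
qed

lemma expected_minimal_movement_le:
  fixes N :: "'d::finite \<Rightarrow> real \<Rightarrow> 'w \<Rightarrow> nat"
  assumes poisson: "\<And>j. poisson_process M (real m) (N j)"
    and "1 \<le> m" "0 < a" "0 < \<epsilon>" "\<epsilon> \<le> \<tau>"
  defines "cost \<equiv> \<lambda>\<omega>. minimal_movement a ((1 + \<epsilon>) / real m) ((1 + \<tau>) / real m) m (initial_position N \<omega>)"
  shows "integrable M cost"
    and "integral\<^sup>L M cost
      \<le> real CARD('d) * (2 powr a * ((1 + \<epsilon>) powr a + moment_bound a)) * real (m ^ CARD('d))"
proof -
  interpret prob_space M by (rule poisson_process_prob_space[OF poisson])
  let ?s = "(1 + \<epsilon>) / real m"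
  let ?x = "\<lambda>\<omega>. initial_position N \<omega>"
  \<comment> \<open>An integrable majorant of the cost: grid coordinates are at most
    \<open>m * s = 1 + \<epsilon>\<close>, and the arrival times have uniformly bounded
    moments.\<close>
  define B where "B \<omega> = (\<Sum>i\<in>sensors m. \<Sum>j\<in>UNIV.
    2 powr a * ((1 + \<epsilon>) powr a + \<bar>arrival_time (N j) (i j) \<omega>\<bar> powr a))" for \<omega>
  have adm: "admissible m ?s ((1 + \<tau>) / real m) (\<lambda>i :: 'd \<Rightarrow> nat. \<chi> j. real (i j) * ?s)"
    using assms by (intro admissible_grid) (auto intro: divide_right_mono)
  have le: "cost \<omega> \<le> B \<omega>" for \<omega>
  proof -
    have "cost \<omega> \<le> total_movement a (sensors m) (\<lambda>i. (\<chi> j. real (i j) * ?s) - ?x \<omega> i)"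
      unfolding cost_def by (rule minimal_movement_le[OF adm])
    also have "\<dots> \<le> B \<omega>"
      unfolding total_movement_def B_def
    proof (intro sum_mono)
      fix i :: "'d \<Rightarrow> nat" and j assume "i \<in> sensors m"
      then have "i j \<le> m" by (auto simp: sensors_def PiE_def Pi_def)
      then have "real (i j) * (1 + \<epsilon>) \<le> real m * (1 + \<epsilon>)"
        using assms by (intro mult_right_mono) auto
      then have "real (i j) * ?s \<le> 1 + \<epsilon>"
        using assms by (simp add: pos_divide_le_eq mult.commute)
      then show "\<bar>((\<chi> j. real (i j) * ?s) - ?x \<omega> i) $ j\<bar> powr a
          \<le> 2 powr a * ((1 + \<epsilon>) powr a + \<bar>arrival_time (N j) (i j) \<omega>\<bar> powr a)"
        using assms powr_abs_diff_le[of "real (i j) * ?s" "1 + \<epsilon>" a "arrival_time (N j) (i j) \<omega>"]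
        by (simp add: initial_position_def)
    qed
    finally show ?thesis .
  qed
  have nonneg: "0 \<le> cost \<omega>" for \<omega>
    unfolding cost_def by (rule minimal_movement_ge[OF adm total_movement_nonneg])
  have int: "integrable M (\<lambda>\<omega>. 2 powr a * ((1 + \<epsilon>) powr a + \<bar>arrival_time (N j) (i j) \<omega>\<bar> powr a))"
    if "i \<in> sensors m" for i :: "'d \<Rightarrow> nat" and j
    using that arrival_time_moment(1)[OF poisson[of j] assms(2) _ assms(3), of "i j"]
    by (auto simp: sensors_def PiE_def Pi_def)
  then have intB: "integrable M B"
    unfolding B_def by (intro Bochner_Integration.integrable_sum)
  have "cost \<in> borel_measurable M"
    unfolding cost_def using borel_measurable_initial_position[OF poisson]
      borel_measurable_minimal_movement[OF adm \<open>0 < a\<close>] by (rule measurable_compose)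
  then show "integrable M cost"
    by (rule Bochner_Integration.integrable_bound[OF intB])
      (use nonneg le in \<open>auto intro!: AE_I2 order_trans[OF le abs_ge_self]\<close>)
  then have "integral\<^sup>L M cost \<le> integral\<^sup>L M B"
    by (intro integral_mono intB le)
  also have "\<dots> = (\<Sum>i\<in>sensors m. \<Sum>j\<in>UNIV.
      \<integral>\<omega>. 2 powr a * ((1 + \<epsilon>) powr a + \<bar>arrival_time (N j) (i j) \<omega>\<bar> powr a) \<partial>M)"
    unfolding B_def using int by (simp add: Bochner_Integration.integral_sum)
  also have "\<dots> \<le> (\<Sum>i\<in>(sensors m :: ('d \<Rightarrow> nat) set). \<Sum>j\<in>(UNIV :: 'd set).
      2 powr a * ((1 + \<epsilon>) powr a + moment_bound a))"
  proof (intro sum_mono)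
    fix i :: "'d \<Rightarrow> nat" and j assume "i \<in> sensors m"
    then have "i j \<le> m" by (auto simp: sensors_def PiE_def Pi_def)
    note moment = arrival_time_moment[OF poisson[of j] assms(2) this assms(3)]
    then show "(\<integral>\<omega>. 2 powr a * ((1 + \<epsilon>) powr a + \<bar>arrival_time (N j) (i j) \<omega>\<bar> powr a) \<partial>M)
        \<le> 2 powr a * ((1 + \<epsilon>) powr a + moment_bound a)"
      by (simp add: prob_space)
  qed
  also have "\<dots> = real CARD('d) * (2 powr a * ((1 + \<epsilon>) powr a + moment_bound a)) * real (m ^ CARD('d))"
    by (simp add: card_sensors)
  finally show "integral\<^sup>L M cost
      \<le> real CARD('d) * (2 powr a * ((1 + \<epsilon>) powr a + moment_bound a)) * real (m ^ CARD('d))" .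
qed

lemma expected_minimal_movement_ge:
  fixes N :: "'d::finite \<Rightarrow> real \<Rightarrow> 'w \<Rightarrow> nat"
  assumes poisson: "\<And>j. poisson_process M (real m) (N j)"
    and "1 \<le> m" "0 < a" "0 < \<epsilon>" "\<epsilon> \<le> \<tau>"
    and m_ge: "4 * (1 + \<epsilon>) / \<epsilon> \<le> real m"
    and m_exp: "exp (- real m * (\<epsilon> / 4 - ln (1 + \<epsilon> / 4))) \<le> 1 / 2"
  shows "\<epsilon> / (8 * (1 + \<epsilon>)) * (\<epsilon> / 8) powr a * real (m ^ CARD('d))
    \<le> (\<integral>\<omega>. minimal_movement a ((1 + \<epsilon>) / real m) ((1 + \<tau>) / real m) m (initial_position N \<omega>) \<partial>M)"
proof -
  interpret prob_space M by (rule poisson_process_prob_space[OF poisson])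
  let ?cost = "\<lambda>\<omega>. minimal_movement a ((1 + \<epsilon>) / real m) ((1 + \<tau>) / real m) m (initial_position N \<omega>)"
  let ?s = "(1 + \<epsilon>) / real m"
  let ?c = "\<epsilon> / (4 * (1 + \<epsilon>)) * (\<epsilon> / 8) powr a * real (m ^ CARD('d))"
  \<comment> \<open>Displacements along one arbitrary axis already give the required order.\<close>
  fix j :: 'd
  \<comment> \<open>With margin \<open>\<epsilon> / 8\<close> on both sides the widened strip has
    width \<open>1 + \<epsilon> / 2\<close>, less than \<open>m * s = 1 + \<epsilon>\<close>. On
    \<open>E\<close> the first \<open>m\<close> arrivals of process \<open>j\<close> all occur by
    time \<open>t\<close>.\<close>
  define t where "t = 1 + \<epsilon> / 4"
  define E where "E = {\<omega> \<in> space M. m \<le> N j t \<omega>}"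
  have "0 < ?s" "1 \<le> t" using assms by (auto simp: t_def)
  have [measurable]: "N j t \<in> measurable M (count_space UNIV)"
    using poisson_process_measurable[OF poisson] \<open>1 \<le> t\<close> by simp
  have E [measurable]: "E \<in> sets M" unfolding E_def by measurable
  have "prob {\<omega> \<in> space M. N j t \<omega> < m} \<le> 1 / 2"
    using poisson_process_lower_tail[OF poisson[of j] refl \<open>1 \<le> m\<close> \<open>1 \<le> t\<close>] m_exp
    by (simp add: t_def)
  moreover have "{\<omega> \<in> space M. N j t \<omega> < m} = space M - E" by (auto simp: E_def)
  ultimately have prob_E: "1 / 2 \<le> prob E" using prob_compl[OF E] by simp
  have adm: "admissible m ?s ((1 + \<tau>) / real m) (\<lambda>i :: 'd \<Rightarrow> nat. \<chi> j. real (i j) * ?s)"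
    using assms by (intro admissible_grid) (auto intro: divide_right_mono)
  have cost_E: "?c \<le> ?cost \<omega>" if \<omega>: "\<omega> \<in> E" for \<omega>
  proof (rule minimal_movement_ge[OF adm])
    fix y :: "('d \<Rightarrow> nat) \<Rightarrow> real ^ 'd" assume y: "admissible m ?s ((1 + \<tau>) / real m) y"
    have "0 \<le> initial_position N \<omega> i $ j \<and> initial_position N \<omega> i $ j \<le> t" if "i \<in> sensors m" for i
    proof -
      have "i j \<le> N j t \<omega>"
        using that \<omega> by (auto simp: sensors_def PiE_def Pi_def E_def intro: order_trans)
      then show ?thesis
        using arrival_time_bounds[OF poisson[of j], of t "i j" \<omega>] \<open>1 \<le> t\<close>
        by (simp add: initial_position_def)
    qed
    then have "(real m ^ CARD('d) - real m ^ (CARD('d) - 1) * ((t + 2 * (\<epsilon> / 8)) / ?s + 1)) * (\<epsilon> / 8) powr a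
        \<le> total_movement a (sensors m) (\<lambda>i. y i - initial_position N \<omega> i)"
      using assms \<open>0 < ?s\<close> \<open>1 \<le> t\<close> by (intro admissible_movement_ge[OF y]) auto
    moreover have "\<epsilon> / (4 * (1 + \<epsilon>)) * real (m ^ CARD('d))
        \<le> real m ^ CARD('d) - real m ^ (CARD('d) - 1) * ((t + 2 * (\<epsilon> / 8)) / ?s + 1)"
    proof -
      \<comment> \<open>The relative width of the strip is \<open>1 - 2 * q\<close>. The assumption
        \<open>m_ge\<close> says \<open>m * q \<ge> 1\<close>, so one \<open>q\<close> absorbs the
        additive 1 in the count per line and the other remains as the fraction of displaced
        sensors.\<close>
      define q where "q = \<epsilon> / (4 * (1 + \<epsilon>))"
      have "(t + 2 * (\<epsilon> / 8)) / ?s = real m * ((1 + \<epsilon> / 2) / (1 + \<epsilon>))"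
        by (simp add: t_def)
      also have "(1 + \<epsilon> / 2) / (1 + \<epsilon>) = 1 - 2 * q"
        using assms by (simp add: q_def field_simps)
      finally have "(t + 2 * (\<epsilon> / 8)) / ?s = real m - 2 * (real m * q)"
        by (simp add: right_diff_distrib)
      moreover have "1 \<le> real m * q"
        using m_ge assms by (simp add: q_def field_simps)
      ultimately have "(t + 2 * (\<epsilon> / 8)) / ?s + 1 \<le> real m - real m * q"
        by linarith
      then have "real m ^ (CARD('d) - 1) * ((t + 2 * (\<epsilon> / 8)) / ?s + 1)
          \<le> real m ^ (CARD('d) - 1) * (real m - real m * q)"
        by (rule mult_left_mono) simp
      also have "\<dots> = (real m ^ (CARD('d) - 1) * real m) * (1 - q)"
        by (simp only: right_diff_distrib mult.assoc mult_1_right)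
      also have "real m ^ (CARD('d) - 1) * real m = real m ^ CARD('d)"
        by (rule power_minus_mult) simp
      finally show ?thesis unfolding q_def by (simp add: right_diff_distrib mult.commute)
    qed
    then have "\<epsilon> / (4 * (1 + \<epsilon>)) * real (m ^ CARD('d)) * (\<epsilon> / 8) powr a
        \<le> (real m ^ CARD('d) - real m ^ (CARD('d) - 1) * ((t + 2 * (\<epsilon> / 8)) / ?s + 1)) * (\<epsilon> / 8) powr a"
      by (rule mult_right_mono) simp
    ultimately show "?c \<le> total_movement a (sensors m) (\<lambda>i. y i - initial_position N \<omega> i)"
      by (simp only: mult_ac)
  qed
  \<comment> \<open>The cost is at least \<open>?c\<close> on \<open>E\<close> and nonnegative
    elsewhere; \<open>prob E \<ge> 1 / 2\<close> accounts for the change from 4 to 8 in the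
    constant.\<close>
  have "\<epsilon> / (8 * (1 + \<epsilon>)) * (\<epsilon> / 8) powr a * real (m ^ CARD('d)) = ?c * (1 / 2)"
    by simp
  also have "\<dots> \<le> ?c * prob E"
    using assms by (intro mult_left_mono prob_E) auto
  also have "\<dots> = (\<integral>\<omega>. ?c * indicator E \<omega> \<partial>M)"
    using E by simp
  also have "\<dots> \<le> (\<integral>\<omega>. ?cost \<omega> \<partial>M)"
  proof (rule integral_mono)
    show "integrable M (\<lambda>\<omega>. ?c * indicator E \<omega>)"
      using E by (intro integrable_mult_right integrable_real_indicator) (auto simp: emeasure_eq_measure)
    show "integrable M ?cost"
      by (rule expected_minimal_movement_le(1)[OF poisson]) fact+
    show "?c * indicator E \<omega> \<le> ?cost \<omega>" for \<omega>
      using cost_E[of \<omega>] minimal_movement_ge[OF adm total_movement_nonneg]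
      by (cases "\<omega> \<in> E") auto
  qed
  finally show ?thesis .
qed

section \<open>Asymptotics of the expected minimal movement\<close>

theorem theorem11:
  fixes a \<epsilon> \<tau> :: real
    and M :: "nat \<Rightarrow> 'w measure"
    and N :: "nat \<Rightarrow> 'd::finite \<Rightarrow> real \<Rightarrow> 'w \<Rightarrow> nat"
    and cost :: "nat \<Rightarrow> 'w \<Rightarrow> real"
  assumes "CARD('d) \<ge> 2"
    and "a > 0"
    and "0 < \<epsilon>" and "\<epsilon> \<le> \<tau>"
    and "\<And>m. m \<ge> 1 \<Longrightarrow> independent_poisson_processes (M m) (real m) (N m)"
  defines "cost \<equiv> \<lambda>m \<omega>. minimal_movement a ((1 + \<epsilon>) / real m) ((1 + \<tau>) / real m) m
                     (initial_position (N m) \<omega>)"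
  shows "(\<forall>m\<ge>1. integrable (M m) (cost m)) \<and>
         (a \<ge> 1 \<longrightarrow> (\<lambda>m. prob_space.expectation (M m) (cost m)) \<in> \<Theta>(\<lambda>m. real (m ^ CARD('d)))) \<and>
         (a < 1 \<longrightarrow> (\<lambda>m. prob_space.expectation (M m) (cost m)) \<in> O(\<lambda>m. real (m ^ CARD('d))))"
proof -
  have poisson: "poisson_process (M m) (real m) (N m j)" if "1 \<le> m" for m j
    using assms(5)[OF that] by (simp add: independent_poisson_processes_def)
  let ?K = "real CARD('d) * (2 powr a * ((1 + \<epsilon>) powr a + moment_bound a))"
  let ?c = "\<epsilon> / (8 * (1 + \<epsilon>)) * (\<epsilon> / 8) powr a"
  have int: "integrable (M m) (cost m)"
    and le: "integral\<^sup>L (M m) (cost m) \<le> ?K * real (m ^ CARD('d))" if "1 \<le> m" for m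
    unfolding cost_def
    using expected_minimal_movement_le[OF poisson[OF that] that assms(2-4)] by auto
  \<comment> \<open>Strictness makes the decay rate in \<open>m\<close> positive, so the tail
    probability is eventually below \<open>1 / 2\<close>.\<close>
  have "ln (1 + \<epsilon> / 4) < \<epsilon> / 4" using assms(3) ln_add_one_self_less_self[of "\<epsilon> / 4"] by simp
  then have "(\<lambda>m. exp (- real m * (\<epsilon> / 4 - ln (1 + \<epsilon> / 4)))) \<longlonglongrightarrow> 0"
    by real_asymp
  then have "eventually (\<lambda>m. exp (- real m * (\<epsilon> / 4 - ln (1 + \<epsilon> / 4))) < 1 / 2) sequentially"
    by (rule order_tendstoD) simp
  moreover have "eventually (\<lambda>m. 4 * (1 + \<epsilon>) / \<epsilon> \<le> real m) sequentially"
    using filterlim_real_sequentially by (simp add: filterlim_at_top)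
  ultimately have ge: "eventually (\<lambda>m. ?c * real (m ^ CARD('d)) \<le> integral\<^sup>L (M m) (cost m)) sequentially"
    using eventually_ge_at_top[of 1]
  proof eventually_elim
    case (elim m)
    then show ?case
      unfolding cost_def
      using expected_minimal_movement_ge[OF poisson, where m = m and a = a and \<epsilon> = \<epsilon> and \<tau> = \<tau>] assms(2-4) by simp
  qed
  have c_pos: "0 < ?c" using assms by simp
  have O: "(\<lambda>m. integral\<^sup>L (M m) (cost m)) \<in> O(\<lambda>m. real (m ^ CARD('d)))"
  proof (rule bigoI)
    show "eventually (\<lambda>m. norm (integral\<^sup>L (M m) (cost m)) \<le> ?K * norm (real (m ^ CARD('d)))) sequentially"
      using ge eventually_ge_at_top[of 1]
    proof eventually_elim
      case (elim m)
      \<comment> \<open>The lower bound shows that the expectation is nonnegative, which removes the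
        norm.\<close>
      have "0 \<le> ?c * real (m ^ CARD('d))" using less_imp_le[OF c_pos] by (rule mult_nonneg_nonneg) simp
      then show ?case using elim(1) le[OF elim(2)] by simp
    qed
  qed
  moreover have "(\<lambda>m. integral\<^sup>L (M m) (cost m)) \<in> \<Omega>(\<lambda>m. real (m ^ CARD('d)))"
  proof (rule landau_omega.bigI[OF c_pos])
    show "eventually (\<lambda>m. ?c * norm (real (m ^ CARD('d))) \<le> norm (integral\<^sup>L (M m) (cost m))) sequentially"
      using ge by eventually_elim simp
  qed
  ultimately show ?thesis using int by (auto intro: bigthetaI)
qed

end
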